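(* Let $r>0$, let $\mathbf{k}=(k_1,\ldots,k_{r-1};k_r)$ with all $k_i\in\mathbb{N}$, and let $\sigma\in\mathfrak{S}_r$. Then $$\pi\big((M^{(\mathbf{k})}-M^{(\sigma(\mathbf{k}))})x_1\big)\in\operatorname{Ker}\mathrm{Li}^-_\bullet,$$ where $\sigma(\mathbf{k}):=(k_{\sigma(1)},\ldots,k_{\sigma(r-1)};k_{\sigma(r)})$.
   Context: $\mathbb{N}$ is the set of non-negative integers. For $\mathbf{s}=(s_1,\ldots,s_m)\in\mathbb{N}^m$ put $\mathrm{Li}^-_{\mathbf{s}}(z):=\sum_{n_1>\cdots>n_m>0}n_1^{s_1}\cdots n_m^{s_m}z^{n_1}$ for $|z|<1$ (empty index gives $1$), a rational function in $\mathbb{C}[z,(1-z)^{-1}]$. Let $\mathbb{C}\langle Y\rangle$ be the free associative $\mathbb{C}$-algebra on $Y=\{y_0,y_1,\ldots\}$ and $\mathrm{Li}^-_\bullet:\mathbb{C}\langle Y\rangle\to\mathbb{C}[z,(1-z)^{-1}]$ the $\mathbb{C}$-linear map with $y_{s_1}\cdots y_{s_m}\mapsto\mathrm{Li}^-_{(s_1,\ldots,s_m)}$. Let $\pi:\mathbb{C}\langle x_0,x_1\rangle x_1\to\mathbb{C}\langle Y\rangle$ be the linear isomorphism from the span of words in $x_0,x_1$ ending in $x_1$, $x_0^{s_1}x_1\cdots x_0^{s_m}x_1\mapsto y_{s_1}\cdots y_{s_m}$. Define $x_1^{(0)}:=x_1$, $x_1^{(n)}:=x_0x_1^{(n-1)}-x_1^{(n-1)}x_0$,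 and the Magnus polynomial $M^{(k_1,\ldots,k_{r-1};k_r)}:=x_1^{(k_1)}\cdots x_1^{(k_{r-1})}x_0^{k_r}$. *)

theory Defs
  imports "HOL-Analysis.Analysis" "HOL-Combinatorics.Permutations" "HOL-Library.Poly_Mapping"
begin

text \<open>
  Lists under concatenation form the free monoid. Via the convolution product of
  \<^theory>\<open>HOL-Library.Poly_Mapping\<close>, the type \<open>'a list \<Rightarrow>\<^sub>0 complex\<close> is then the free associative
  \<open>\<complex>\<close>-algebra on the letters \<open>'a\<close>.
\<close>

instantiation list :: (type) monoid_add
begin

definition zero_list :: "'a list" where "zero_list = []"

definition plus_list :: "'a list \<Rightarrow> 'a list \<Rightarrow> 'a list" where "plus_list = (@)"

instance by standard (simp_all add: zero_list_def plus_list_def)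

end

datatype xletter = X0 | X1

type_synonym xalg = "xletter list \<Rightarrow>\<^sub>0 complex"

text \<open>The letter \<open>y\<^sub>s\<close> is represented by the natural number \<open>s\<close>.\<close>

type_synonym yalg = "nat list \<Rightarrow>\<^sub>0 complex"

definition x0 :: xalg where "x0 = Poly_Mapping.single [X0] 1"

definition x1 :: xalg where "x1 = Poly_Mapping.single [X1] 1"

lemma single_mult_single_list:
  "Poly_Mapping.single u a * Poly_Mapping.single v b = Poly_Mapping.single (u @ v) (a * b :: complex)"
  by (simp add: mult_single plus_list_def)

fun x1_iter :: "nat \<Rightarrow> xalg" where
  "x1_iter 0 = x1"
| "x1_iter (Suc n) = x0 * x1_iter n - x1_iter n * x0"

text \<open>The index \<open>(k\<^sub>1, \<dots>, k\<^sub>r\<^sub>-\<^sub>1; k\<^sub>r)\<close> is given by \<open>r\<close> and the values of \<open>k\<close> on \<open>{1..r}\<close>.\<close>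

definition magnus :: "nat \<Rightarrow> (nat \<Rightarrow> nat) \<Rightarrow> xalg" where
  "magnus r k = prod_list (map (\<lambda>i. x1_iter (k i)) [1..<r]) * x0 ^ k r"

text \<open>
  \<open>ywords n w\<close> reads off the exponents of \<open>x\<^sub>0\<^sup>n w\<close>, so \<open>ywords 0\<close> is the map
  \<open>x\<^sub>0\<^sup>s\<^sup>1 x\<^sub>1 \<cdots> x\<^sub>0\<^sup>s\<^sup>m x\<^sub>1 \<mapsto> y\<^sub>s\<^sub>1 \<cdots> y\<^sub>s\<^sub>m\<close>; its values on words not ending in \<open>x\<^sub>1\<close> are immaterial.
\<close>

fun ywords :: "nat \<Rightarrow> xletter list \<Rightarrow> nat list" where
  "ywords n [] = []"
| "ywords n (X0 # w) = ywords (Suc n) w"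
| "ywords n (X1 # w) = n # ywords 0 w"

lemma ywords_replicate: "ywords n (replicate s X0 @ w) = ywords (n + s) w"
  by (induction s arbitrary: n) auto

lemma ywords_xword: "ywords 0 (concat (map (\<lambda>s. replicate s X0 @ [X1]) ss)) = ss"
  by (induction ss) (auto simp: ywords_replicate)

lemma xword_ywords:
  "w \<noteq> [] \<Longrightarrow> last w = X1 \<Longrightarrow>
    concat (map (\<lambda>s. replicate s X0 @ [X1]) (ywords n w)) = replicate n X0 @ w"
proof (induction n w rule: ywords.induct)
  case (2 n w)
  then show ?case by (cases "w = []") (auto simp: replicate_app_Cons_same)
next
  case (3 n w)
  then show ?case by (cases "w = []") auto
qed simp

text \<open>The linear map \<open>\<pi>\<close>, to be applied to elements of \<open>\<complex>\<langle>x\<^sub>0,x\<^sub>1\<rangle>x\<^sub>1\<close>.\<close>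

definition pi_Y :: "xalg \<Rightarrow> yalg" where
  "pi_Y p = (\<Sum>w\<in>Poly_Mapping.keys p.
     Poly_Mapping.single (ywords 0 w) (Poly_Mapping.lookup p w))"

lemma pi_Y_xword:
  "pi_Y (Poly_Mapping.single (concat (map (\<lambda>s. replicate s X0 @ [X1]) ss)) c)
     = Poly_Mapping.single ss c"
  by (simp add: pi_Y_def ywords_xword)

lemma pi_Y_add: "pi_Y (p + q) = pi_Y p + pi_Y q"
proof -
  have *: "pi_Y u = (\<Sum>w\<in>A. Poly_Mapping.single (ywords 0 w) (Poly_Mapping.lookup u w))"
    if "finite A" "Poly_Mapping.keys u \<subseteq> A" for A and u :: xalg
    unfolding pi_Y_def using that
    by (intro sum.mono_neutral_left) (auto simp: in_keys_iff)
  let ?A = "Poly_Mapping.keys p \<union> Poly_Mapping.keys q"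
  have "Poly_Mapping.keys (p + q) \<subseteq> ?A"
    by (rule Poly_Mapping.keys_add)
  then show ?thesis
    by (simp add: *[of ?A] lookup_add single_add sum.distrib)
qed

definition index_tuples :: "nat \<Rightarrow> nat list set" where
  "index_tuples m = {ns. length ns = m \<and> sorted_wrt (>) ns \<and> 0 \<notin> set ns}"

definition Li_neg :: "nat list \<Rightarrow> complex \<Rightarrow> complex" where
  "Li_neg s z = (if s = [] then 1 else
     (\<Sum>\<^sub>\<infinity>ns\<in>index_tuples (length s).
        (\<Prod>i<length s. of_nat (ns ! i) ^ (s ! i)) * z ^ hd ns))"

definition Li_neg_map :: "yalg \<Rightarrow> complex \<Rightarrow> complex" where
  "Li_neg_map p z = (\<Sum>s\<in>Poly_Mapping.keys p. Poly_Mapping.lookup p s * Li_neg s z)"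

text \<open>
  An element of \<open>\<complex>[z,(1-z)\<^sup>-\<^sup>1]\<close> is identified with the function it defines on the open unit disc,
  where the series converge; it is zero iff that function vanishes.
\<close>

definition Ker_Li_neg :: "yalg set" where
  "Ker_Li_neg = {p. \<forall>z\<in>ball 0 1. Li_neg_map p z = 0}"

end

theory Submission
  imports Defs
begin

text \<open>
  Let \<open>\<theta> = z d/dz\<close> and \<open>\<lambda> = z/(1-z)\<close>. Sending \<open>x\<^sub>0\<close> to \<open>\<theta>\<close> and \<open>x\<^sub>1\<close> to multiplication by
  \<open>\<lambda>\<close> makes \<open>\<complex>\<langle>x\<^sub>0,x\<^sub>1\<rangle>\<close> act on power series in such a way that \<open>Li\<^sup>-\<^sub>s\<close> is the image of \<open>1\<close> under
  the word that \<open>\<pi>\<close> sends to \<open>y\<^sub>s\<close>. Since \<open>\<theta>\<close> is a derivation, \<open>x\<^sub>1\<^sup>(\<^sup>n\<^sup>)\<close> acts as multiplication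
  by \<open>\<theta>\<^sup>n \<lambda>\<close>. Hence \<open>M\<^sup>(\<^sup>k\<^sup>) x\<^sub>1\<close> sends \<open>1\<close> to \<open>\<theta>\<^sup>k\<^sup>1 \<lambda> \<cdots> \<theta>\<^sup>k\<^sup>r \<lambda>\<close>, a product of commuting factors.
\<close>

section \<open>The action of the free algebra on power series\<close>

definition euler_op :: "complex fps \<Rightarrow> complex fps" where
  "euler_op f = fps_X * fps_deriv f"

definition lambda_fps :: "complex fps" where
  "lambda_fps = Abs_fps (\<lambda>n. if n = 0 then 0 else 1)"

fun letter_act :: "xletter \<Rightarrow> complex fps \<Rightarrow> complex fps" where
  "letter_act X0 f = euler_op f"
| "letter_act X1 f = lambda_fps * f"

definition word_act :: "xletter list \<Rightarrow> complex fps \<Rightarrow> complex fps" where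
  "word_act w f = foldr letter_act w f"

definition alg_act :: "xalg \<Rightarrow> complex fps \<Rightarrow> complex fps" where
  "alg_act p f = (\<Sum>w\<in>Poly_Mapping.keys p. fps_const (Poly_Mapping.lookup p w) * word_act w f)"

lemma fps_nth_euler_op: "fps_nth (euler_op f) n = of_nat n * fps_nth f n"
  by (cases n) (simp_all add: euler_op_def)

lemma fps_nth_euler_op_funpow: "fps_nth ((euler_op ^^ s) f) n = of_nat n ^ s * fps_nth f n"
  by (induction s) (simp_all add: fps_nth_euler_op)

text \<open>The constant coefficient of \<open>lambda_fps\<close> vanishes, so the partial sum stops
  before \<open>n\<close>; this strict bound becomes the condition n_1 > n_2 in the polylogarithm
  series.\<close>

lemma fps_nth_lambda_mult: "fps_nth (lambda_fps * f) n = (\<Sum>j<n. fps_nth f j)"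
proof -
  have "fps_nth (lambda_fps * f) n = (\<Sum>j=0..n. fps_nth f j * fps_nth lambda_fps (n - j))"
    by (simp add: mult.commute[of lambda_fps] fps_mult_nth)
  also have "\<dots> = (\<Sum>j<n. fps_nth f j)"
    by (intro sum.mono_neutral_cong_right) (auto simp: lambda_fps_def)
  finally show ?thesis .
qed

lemma euler_op_mult: "euler_op (f * g) = euler_op f * g + f * euler_op g"
  by (simp add: euler_op_def algebra_simps)

lemma word_act_Nil [simp]: "word_act [] f = f"
  and word_act_Cons [simp]: "word_act (a # w) f = letter_act a (word_act w f)"
  and word_act_append [simp]: "word_act (v @ w) f = word_act v (word_act w f)"
  by (simp_all add: word_act_def)

lemma letter_act_add: "letter_act a (f + g) = letter_act a f + letter_act a g"
  by (cases a) (simp_all add: euler_op_def algebra_simps)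

lemma letter_act_scale: "letter_act a (fps_const c * f) = fps_const c * letter_act a f"
  by (cases a) (simp_all add: euler_op_def algebra_simps)

lemma word_act_add: "word_act w (f + g) = word_act w f + word_act w g"
  by (induction w) (simp_all add: letter_act_add)

lemma word_act_scale: "word_act w (fps_const c * f) = fps_const c * word_act w f"
  by (induction w) (simp_all add: letter_act_scale)

lemma word_act_sum: "word_act w (\<Sum>i\<in>A. f i) = (\<Sum>i\<in>A. word_act w (f i))"
proof -
  have "word_act w 0 = 0"
    using word_act_scale[of w 0 0] by simp
  then show ?thesis
    by (induction A rule: infinite_finite_induct) (simp_all add: word_act_add)
qed

lemma poly_mapping_eq_sum_single:
  "p = (\<Sum>w\<in>Poly_Mapping.keys p. Poly_Mapping.single w (Poly_Mapping.lookup p w))"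
  by (rule poly_mapping_eqI)
    (auto simp: lookup_sum lookup_single when_def in_keys_iff)

text \<open>Extra words contribute zero; a common index set lets \<open>p\<close>, \<open>q\<close>
  and \<open>p + q\<close> be compared even when cancellation shrinks the support.\<close>

lemma alg_act_superset:
  assumes "finite A" "Poly_Mapping.keys p \<subseteq> A"
  shows "alg_act p f = (\<Sum>w\<in>A. fps_const (Poly_Mapping.lookup p w) * word_act w f)"
  unfolding alg_act_def using assms
  by (intro sum.mono_neutral_left) (auto simp: in_keys_iff)

lemma alg_act_add: "alg_act (p + q) f = alg_act p f + alg_act q f"
proof -
  let ?A = "Poly_Mapping.keys p \<union> Poly_Mapping.keys q"
  have "Poly_Mapping.keys (p + q) \<subseteq> ?A"
    by (rule Poly_Mapping.keys_add)
  then show ?thesis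
    by (simp add: alg_act_superset[of ?A] lookup_add sum.distrib distrib_right
        flip: fps_const_add)
qed

lemma alg_act_diff: "alg_act (p - q) f = alg_act p f - alg_act q f"
  using alg_act_add[of "p - q" q f] by simp

lemma alg_act_single: "alg_act (Poly_Mapping.single w c) f = fps_const c * word_act w f"
  by (simp add: alg_act_def)

lemma alg_act_sum: "alg_act (\<Sum>i\<in>A. p i) f = (\<Sum>i\<in>A. alg_act (p i) f)"
  by (induction A rule: infinite_finite_induct) (simp_all add: alg_act_add, simp_all add: alg_act_def)

text \<open>Expanding both factors reduces the claim to words, where concatenation acts by
  composition; linearity of each word's action reassembles the inner sum.\<close>

lemma alg_act_mult: "alg_act (p * q) f = alg_act p (alg_act q f)"
proof -
  let ?l = Poly_Mapping.lookup
  have "p * q = (\<Sum>u\<in>Poly_Mapping.keys p. \<Sum>v\<in>Poly_Mapping.keys q.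
      Poly_Mapping.single (u @ v) (?l p u * ?l q v))"
    by (subst poly_mapping_eq_sum_single[of p], subst poly_mapping_eq_sum_single[of q])
      (simp add: sum_product single_mult_single_list)
  then have "alg_act (p * q) f = (\<Sum>u\<in>Poly_Mapping.keys p. \<Sum>v\<in>Poly_Mapping.keys q.
      fps_const (?l p u * ?l q v) * word_act u (word_act v f))"
    by (simp add: alg_act_sum alg_act_single)
  also have "\<dots> = alg_act p (alg_act q f)"
    by (simp add: alg_act_def word_act_sum word_act_scale sum_distrib_left mult.assoc
        flip: fps_const_mult)
  finally show ?thesis .
qed

lemma alg_act_one: "alg_act 1 f = f"
  using alg_act_single[of 0 1 f, unfolded single_one] by (simp add: zero_list_def)

lemma alg_act_x0: "alg_act x0 f = euler_op f"
  by (simp add: x0_def alg_act_single)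

lemma alg_act_x0_power: "alg_act (x0 ^ n) f = (euler_op ^^ n) f"
  by (induction n) (simp_all add: alg_act_one alg_act_mult alg_act_x0)

lemma alg_act_x1_iter: "alg_act (x1_iter n) f = (euler_op ^^ n) lambda_fps * f"
\<comment> \<open>The commutator needs the hypothesis for \<open>f\<close> and for
  \<open>euler_op f\<close>. By the Leibniz rule the terms containing \<open>euler_op f\<close>
  cancel.\<close>
proof (induction n arbitrary: f)
  case 0
  show ?case by (simp add: x1_def alg_act_single)
next
  case (Suc n)
  then show ?case
    by (simp add: alg_act_diff alg_act_mult alg_act_x0 euler_op_mult)
qed

text \<open>The argument \<open>lambda_fps\<close> is the trailing \<open>x1\<close> applied to 1.
  It turns \<open>x0 ^ k r\<close> into a factor of the same shape as the others, hence the
  symmetric product.\<close>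

lemma alg_act_magnus:
  assumes "r > 0"
  shows "alg_act (magnus r k) lambda_fps = (\<Prod>i\<in>{1..r}. (euler_op ^^ k i) lambda_fps)"
proof -
  have "alg_act (prod_list (map (\<lambda>i. x1_iter (k i)) xs)) f =
      prod_list (map (\<lambda>i. (euler_op ^^ k i) lambda_fps) xs) * f" for xs f
    by (induction xs) (simp_all add: alg_act_one alg_act_mult alg_act_x1_iter mult.assoc)
  then have "alg_act (magnus r k) lambda_fps =
      (\<Prod>i\<in>{1..<r}. (euler_op ^^ k i) lambda_fps) * (euler_op ^^ k r) lambda_fps"
    by (simp add: magnus_def alg_act_mult alg_act_x0_power prod.distinct_set_conv_list[symmetric])
  also have "\<dots> = (\<Prod>i\<in>{1..r}. (euler_op ^^ k i) lambda_fps)"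
    using assms by (subst prod.last_plus) (auto simp: mult.commute)
  finally show ?thesis .
qed

section \<open>Polylogarithms as values of power series\<close>

text \<open>The Taylor series of the polylogarithm, built from the inside out: multiplying by
  \<open>lambda_fps\<close> adds a new largest summation index, and the power of
  \<open>euler_op\<close> supplies its weight.\<close>

definition Li_fps :: "nat list \<Rightarrow> complex fps" where
  "Li_fps s = foldr (\<lambda>a f. (euler_op ^^ a) (lambda_fps * f)) s 1"

lemma Li_fps_Nil [simp]: "Li_fps [] = 1"
  and Li_fps_Cons [simp]: "Li_fps (a # s) = (euler_op ^^ a) (lambda_fps * Li_fps s)"
  by (simp_all add: Li_fps_def)

text \<open>The counter \<open>n\<close> records letters \<open>X0\<close> read but not yet closed
  by an \<open>X1\<close>; they are the \<open>n\<close> outer applications of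
  \<open>euler_op\<close>. The final \<open>X1\<close> turns 1 into
  \<open>lambda_fps\<close>.\<close>

lemma Li_fps_ywords:
  "Li_fps (ywords n (w @ [X1])) = (euler_op ^^ n) (word_act w lambda_fps)"
proof (induction w arbitrary: n)
  case (Cons a w)
  then show ?case by (cases a) (simp_all add: funpow_swap1)
qed simp

text \<open>Evaluation respects sums and products of series where they converge, so each operation
  used must keep the radius at least 1.\<close>

lemma conv_radius_euler_op: "fps_conv_radius (euler_op f) \<ge> fps_conv_radius f"
proof -
  have "fps_conv_radius f \<le> fps_conv_radius (fps_deriv f)"
    by (rule fps_conv_radius_deriv)
  also have "\<dots> \<le> fps_conv_radius (euler_op f)"
    unfolding euler_op_def using fps_conv_radius_mult[of fps_X "fps_deriv f"] by simp
  finally show ?thesis .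
qed

lemma conv_radius_euler_op_funpow: "fps_conv_radius ((euler_op ^^ n) f) \<ge> fps_conv_radius f"
  by (induction n) (auto intro: order_trans conv_radius_euler_op)

lemma conv_radius_lambda: "fps_conv_radius lambda_fps \<ge> 1"
  unfolding fps_conv_radius_def
proof (rule conv_radius_geI_ex')
  fix r :: real assume r: "0 < r" "ereal r < 1"
  then have "summable (\<lambda>n. r ^ n)"
    by (simp add: summable_geometric)
  then show "summable (\<lambda>n. fps_nth lambda_fps n * complex_of_real r ^ n)"
    by (rule summable_comparison_test'[where N = 0])
      (use r in \<open>auto simp: lambda_fps_def norm_mult norm_power\<close>)
qed

lemma conv_radius_lambda_mult:
  "fps_conv_radius f \<ge> 1 \<Longrightarrow> fps_conv_radius (lambda_fps * f) \<ge> 1"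
  using fps_conv_radius_mult[of lambda_fps f] conv_radius_lambda
  by (meson min.boundedI order_trans)

lemma conv_radius_word_act: "fps_conv_radius (word_act w lambda_fps) \<ge> 1"
proof (induction w)
  case (Cons a w)
  then show ?case
    by (cases a) (auto intro: conv_radius_lambda_mult order_trans conv_radius_euler_op)
qed (simp add: conv_radius_lambda)

lemma conv_radius_Li_fps: "fps_conv_radius (Li_fps s) \<ge> 1"
proof (induction s)
  case (Cons a s)
  then show ?case
    by (auto intro: conv_radius_lambda_mult order_trans conv_radius_euler_op_funpow)
qed simp

lemma eval_fps_alg_act:
  assumes "norm z < 1"
  shows "eval_fps (alg_act p lambda_fps) z =
    (\<Sum>w\<in>Poly_Mapping.keys p. Poly_Mapping.lookup p w * eval_fps (word_act w lambda_fps) z)"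
proof -
  define g where "g w = fps_const (Poly_Mapping.lookup p w) * word_act w lambda_fps" for w
  have z: "ereal (norm z) < 1"
    using assms by simp
  have g: "fps_conv_radius (g w) \<ge> 1" for w
    using fps_conv_radius_mult[of "fps_const (Poly_Mapping.lookup p w)" "word_act w lambda_fps"]
      conv_radius_word_act[of w] by (auto simp: g_def intro: order_trans)
  have eval_g: "eval_fps (g w) z = Poly_Mapping.lookup p w * eval_fps (word_act w lambda_fps) z" for w
    unfolding g_def using less_le_trans[OF z conv_radius_word_act[of w]]
    by (subst eval_fps_mult) auto
  \<comment> \<open>The radius bound is carried along because \<open>eval_fps_add\<close> needs it
    for the partial sum.\<close>
  have "fps_conv_radius (sum g A) \<ge> 1 \<and> eval_fps (sum g A) z = (\<Sum>w\<in>A. eval_fps (g w) z)"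
    if "finite A" for A
    using that
  proof induction
    case (insert w A)
    then have "fps_conv_radius (g w + sum g A) \<ge> 1"
      using fps_conv_radius_add[of "g w" "sum g A"] g[of w] by (meson min.boundedI order_trans)
    moreover have "eval_fps (g w + sum g A) z = eval_fps (g w) z + eval_fps (sum g A) z"
      using insert z g[of w] by (intro eval_fps_add) (blast intro: less_le_trans)+
    ultimately show ?case using insert by simp
  qed simp
  then show ?thesis
    by (simp add: alg_act_def eval_g flip: g_def)
qed

text \<open>The empty tuple is given head \<open>0\<close>, which makes the recursion on the length uniform.\<close>

definition head_tuples :: "nat \<Rightarrow> nat \<Rightarrow> nat list set" where
  "head_tuples m n = {ns \<in> index_tuples m. (case ns of [] \<Rightarrow> 0 | j # _ \<Rightarrow> j) = n}"

definition tuple_weight :: "nat list \<Rightarrow> nat list \<Rightarrow> nat" where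
  "tuple_weight s ns = (\<Prod>i<length s. (ns ! i) ^ (s ! i))"

lemma head_tuples_0: "head_tuples 0 n = (if n = 0 then {[]} else {})"
  by (auto simp: head_tuples_def index_tuples_def)

text \<open>Deleting the head \<open>n\<close> leaves a tuple with smaller head \<open>j\<close>.
  For \<open>m = 0\<close> only \<open>j = 0\<close> occurs, and \<open>0 < n\<close> is then the
  positivity of the single entry.\<close>

lemma head_tuples_Suc: "head_tuples (Suc m) n = (\<Union>j<n. (#) n ` head_tuples m j)"
proof (intro equalityI subsetI)
  fix ns assume "ns \<in> head_tuples (Suc m) n"
  then obtain ns' where ns: "ns = n # ns'" "n # ns' \<in> index_tuples (Suc m)"
    by (auto simp: head_tuples_def index_tuples_def length_Suc_conv)
  then have "ns' \<in> head_tuples m (case ns' of [] \<Rightarrow> 0 | j # _ \<Rightarrow> j)"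
    "(case ns' of [] \<Rightarrow> 0 | j # _ \<Rightarrow> j) < n"
    by (auto simp: head_tuples_def index_tuples_def split: list.splits)
  then show "ns \<in> (\<Union>j<n. (#) n ` head_tuples m j)"
    using ns by blast
next
  fix ns assume "ns \<in> (\<Union>j<n. (#) n ` head_tuples m j)"
  then obtain j ns' where "j < n" "ns = n # ns'" "ns' \<in> head_tuples m j"
    by blast
  then show "ns \<in> head_tuples (Suc m) n"
    by (cases ns') (auto simp: head_tuples_def index_tuples_def)
qed

lemma finite_head_tuples: "finite (head_tuples m n)"
  by (induction m arbitrary: n) (simp_all add: head_tuples_0 head_tuples_Suc)

lemma tuple_weight_Cons: "tuple_weight (a # s) (n # ns) = n ^ a * tuple_weight s ns"
  by (simp add: tuple_weight_def prod.lessThan_Suc_shift del: prod.lessThan_Suc)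

lemma fps_nth_Li_fps:
  "fps_nth (Li_fps s) n = of_nat (\<Sum>ns\<in>head_tuples (length s) n. tuple_weight s ns)"
proof (induction s arbitrary: n)
  case Nil
  show ?case by (simp add: head_tuples_0 tuple_weight_def)
next
  case (Cons a s)
  have "(\<Sum>ns\<in>head_tuples (Suc (length s)) n. tuple_weight (a # s) ns) =
      (\<Sum>j<n. \<Sum>ns\<in>(#) n ` head_tuples (length s) j. tuple_weight (a # s) ns)"
    unfolding head_tuples_Suc
    by (intro sum.UNION_disjoint) (auto simp: finite_head_tuples, auto simp: head_tuples_def)
  also have "\<dots> = (\<Sum>j<n. \<Sum>ns\<in>head_tuples (length s) j. n ^ a * tuple_weight s ns)"
    by (simp add: sum.reindex tuple_weight_Cons)
  also have "\<dots> = n ^ a * (\<Sum>j<n. \<Sum>ns\<in>head_tuples (length s) j. tuple_weight s ns)"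
    by (simp add: sum_distrib_left)
  finally show ?case
    by (simp add: fps_nth_euler_op_funpow fps_nth_lambda_mult Cons.IH)
qed

text \<open>The unordered sum over tuples is regrouped by the largest entry, each finite group
  giving one term of the power series; absolute convergence justifies this.\<close>

lemma Li_neg_eq_eval_fps:
  assumes "norm z < 1"
  shows "Li_neg s z = eval_fps (Li_fps s) z"
proof (cases "s = []")
  case False
  define B where "B = head_tuples (length s)"
  define f :: "nat \<times> nat list \<Rightarrow> complex"
    where "f = (\<lambda>(n, ns). of_nat (tuple_weight s ns) * z ^ n)"
  have coeff: "fps_nth (Li_fps s) n = of_nat (\<Sum>ns\<in>B n. tuple_weight s ns)" for n
    by (simp add: fps_nth_Li_fps B_def)
  have finB: "finite (B n)" for n
    by (simp add: B_def finite_head_tuples)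
  have "ereal (norm z) < fps_conv_radius (Li_fps s)"
    using assms by (intro less_le_trans[OF _ conv_radius_Li_fps]) simp
  then have sm: "summable (\<lambda>n. norm (fps_nth (Li_fps s) n * z ^ n))"
    by (intro norm_summable_fps) auto
  have "(\<lambda>n. norm (fps_nth (Li_fps s) n * z ^ n)) summable_on UNIV"
    using sm by (intro norm_summable_imp_summable_on) simp
  \<comment> \<open>The weights are natural numbers, so within a group the norms add up exactly to
    the norm of the term.\<close>
  moreover have "((\<lambda>ns. norm (f (n, ns))) has_sum norm (fps_nth (Li_fps s) n * z ^ n)) (B n)" for n
    by (rule has_sum_finiteI[OF finB])
      (simp add: f_def coeff norm_mult sum_distrib_right del: of_nat_sum, simp add: sum_distrib_right)
  ultimately have "(\<lambda>x. norm (f x)) summable_on Sigma UNIV B"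
    by (intro summable_on_SigmaI) auto
  then have "f summable_on Sigma UNIV B"
    by (rule abs_summable_summable)
  moreover have "((\<lambda>n. fps_nth (Li_fps s) n * z ^ n) has_sum eval_fps (Li_fps s) z) UNIV"
    unfolding eval_fps_def
    using sm by (intro norm_summable_imp_has_sum) (auto dest: summable_norm_cancel)
  moreover have "((\<lambda>ns. f (n, ns)) has_sum fps_nth (Li_fps s) n * z ^ n) (B n)" for n
    by (rule has_sum_finiteI[OF finB]) (simp add: f_def coeff sum_distrib_right)
  ultimately have "(f has_sum eval_fps (Li_fps s) z) (Sigma UNIV B)"
    by (intro has_sum_SigmaI) auto
  \<comment> \<open>Each tuple is paired with its head; as \<open>s\<close> is nonempty, the default
    head 0 never arises.\<close>
  moreover have "(f has_sum S) (Sigma UNIV B) \<longleftrightarrow>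
    ((\<lambda>ns. (\<Prod>i<length s. of_nat (ns ! i) ^ (s ! i)) * z ^ hd ns) has_sum S)
      (index_tuples (length s))" for S
    using False
    by (intro has_sum_reindex_bij_witness[of _ "\<lambda>ns. (hd ns, ns)" snd])
      (auto simp: f_def B_def head_tuples_def index_tuples_def tuple_weight_def split: list.splits)
  ultimately show ?thesis
    using False by (simp add: Li_neg_def infsumI)
qed (simp add: Li_neg_def)

section \<open>The kernel\<close>

lemma Li_neg_map_add: "Li_neg_map (p + q) z = Li_neg_map p z + Li_neg_map q z"
proof -
  have *: "Li_neg_map u z = (\<Sum>s\<in>A. Poly_Mapping.lookup u s * Li_neg s z)"
    if "finite A" "Poly_Mapping.keys u \<subseteq> A" for A and u :: yalg
    unfolding Li_neg_map_def using that
    by (intro sum.mono_neutral_left) (auto simp: in_keys_iff)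
  let ?A = "Poly_Mapping.keys p \<union> Poly_Mapping.keys q"
  have "Poly_Mapping.keys (p + q) \<subseteq> ?A"
    by (rule Poly_Mapping.keys_add)
  then show ?thesis
    by (simp add: *[of ?A] lookup_add sum.distrib distrib_right)
qed

lemma Li_neg_map_sum: "Li_neg_map (\<Sum>i\<in>A. p i) z = (\<Sum>i\<in>A. Li_neg_map (p i) z)"
  by (induction A rule: infinite_finite_induct)
    (simp_all add: Li_neg_map_add, simp_all add: Li_neg_map_def)

lemma pi_Y_sum: "pi_Y (\<Sum>i\<in>A. p i) = (\<Sum>i\<in>A. pi_Y (p i))"
  by (induction A rule: infinite_finite_induct) (simp_all add: pi_Y_add, simp_all add: pi_Y_def)

text \<open>Both sides are linear in \<open>p\<close>, so single words suffice, and these are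
  covered by \<open>Li_fps_ywords\<close> with \<open>n = 0\<close>.\<close>

lemma Li_neg_map_pi_Y:
  assumes "norm z < 1"
  shows "Li_neg_map (pi_Y (p * x1)) z = eval_fps (alg_act p lambda_fps) z"
proof -
  have "p * x1 = (\<Sum>w\<in>Poly_Mapping.keys p.
      Poly_Mapping.single (w @ [X1]) (Poly_Mapping.lookup p w))"
    by (subst poly_mapping_eq_sum_single[of p])
      (simp add: x1_def sum_distrib_right single_mult_single_list)
  moreover have "Li_neg_map (pi_Y (Poly_Mapping.single (w @ [X1]) c)) z =
      c * eval_fps (word_act w lambda_fps) z" for w c
    using assms Li_fps_ywords[of 0 w]
    by (simp add: pi_Y_def Li_neg_map_def Li_neg_eq_eval_fps)
  ultimately show ?thesis
    using assms by (simp add: pi_Y_sum Li_neg_map_sum eval_fps_alg_act)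
qed

theorem theorem6p1:
  fixes r :: nat and k :: "nat \<Rightarrow> nat" and \<sigma> :: "nat \<Rightarrow> nat"
  assumes "r > 0" and "\<sigma> permutes {1..r}"
  shows "pi_Y ((magnus r k - magnus r (k \<circ> \<sigma>)) * x1) \<in> Ker_Li_neg"
proof -
  \<comment> \<open>The permutation merely reindexes the product over \<open>{1..r}\<close>.\<close>
  have "alg_act (magnus r (k \<circ> \<sigma>)) lambda_fps = alg_act (magnus r k) lambda_fps"
    using prod.permute[OF assms(2), of "\<lambda>i. (euler_op ^^ k i) lambda_fps"]
    by (simp add: alg_act_magnus[OF assms(1)] o_def)
  then show ?thesis
    by (simp add: Ker_Li_neg_def Li_neg_map_pi_Y alg_act_diff)
qed

end
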